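(* Let $f$ be analytic in a punctured neighborhood $\{0<|z-z_0|<r\}$ of $z_0$, so that $z_0$ is an isolated singularity of $f$. Then $z_0$ is an essential singularity of $f$ if and only if there exists a color $c\in\mathbb{T}$ such that every neighborhood of $z_0$ intersects infinitely many distinct isochromatic lines of color $c$ of the phase plot of $f$.
   Context: $\mathbb{T}$ denotes the unit circle in $\mathbb{C}$. For $f$ analytic on a domain $U$, the phase plot is $P(z)=f(z)/|f(z)|$ on $U_0=\{z\in U: f(z)\neq 0\}$. For $c\in\mathbb{T}$, an isochromatic line of color $c$ is a connected component of the set $\{z\in U_0: f'(z)\neq 0,\ P(z)=c\}$ (here $U=\{0<|z-z_0|<r\}$). *)

theory Defs
  imports "HOL-Analysis.Analysis"
begin

definition is_pole :: "('a::topological_space \<Rightarrow> 'b::real_normed_vector) \<Rightarrow> 'a \<Rightarrow> bool"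
  where "is_pole f a = (LIM x (at a). f x :> at_infinity)"

definition not_essential :: "[complex \<Rightarrow> complex, complex] \<Rightarrow> bool" where
  "not_essential f z = (\<exists>x. f\<midarrow>z\<rightarrow>x \<or> is_pole f z)"

definition phase :: "(complex \<Rightarrow> complex) \<Rightarrow> complex \<Rightarrow> complex" where
  "phase f z = f z / complex_of_real (norm (f z))"

definition isochromatic_lines :: "(complex \<Rightarrow> complex) \<Rightarrow> complex set \<Rightarrow> complex \<Rightarrow> complex set set" where
  "isochromatic_lines f U c =
     components {z \<in> U. f z \<noteq> 0 \<and> deriv f z \<noteq> 0 \<and> phase f z = c}"

end

theory Submission
  imports "HOL-Complex_Analysis.Complex_Analysis" Defs
begin

text \<open>An isochromatic line is a component of the noncritical part of the preimage of an open ray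
  from \<open>0\<close>. Since \<open>f\<close> is a local homeomorphism there, such a line is a curve along which \<open>\<bar>f\<bar>\<close> is locally
  injective, hence injective. At an essential singularity, Picard's great theorem provides a value
  \<open>w \<noteq> 0\<close> which is not a critical value and is taken infinitely often in each neighbourhood of \<open>z0\<close>;
  its preimages lie on pairwise distinct lines of colour \<open>w / \<bar>w\<bar>\<close>. Otherwise, one of \<open>f - f z0\<close>,
  \<open>1 / f\<close> is locally the \<open>n\<close>-th power of a conformal map vanishing at \<open>z0\<close> (unless \<open>f\<close> is constant),
  so near \<open>z0\<close> the lines of a given colour are conformal images of finitely many line segments.\<close>

section \<open>Rays from the origin and colours\<close>

text \<open>The parameter is strictly positive, so that for \<open>c\<close> of norm 1 membership
  says at once that a value is non-zero and has phase \<open>c\<close>.\<close>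

definition ray :: "complex \<Rightarrow> complex set" where
  "ray c = (\<lambda>t. complex_of_real t * c) ` {0<..}"

lemma convex_ray: "convex (ray c)"
proof -
  have "ray c = (\<lambda>t. t *\<^sub>R c) ` {0<..}"
    by (simp add: ray_def scaleR_conv_of_real)
  then show ?thesis
    by (simp add: convex_linear_image bounded_linear.linear bounded_linear_scaleR_left)
qed

lemma mem_ray_inverse_iff: "w \<in> ray c \<longleftrightarrow> inverse w \<in> ray (inverse c)"
proof -
  have "inverse w \<in> ray (inverse c)" if "w \<in> ray c" for w c
  proof -
    from that obtain t where "t > 0" "w = of_real t * c"
      by (auto simp: ray_def)
    then have "inverse w = of_real (inverse t) * inverse c" "inverse t > 0"
      by auto
    then show ?thesis unfolding ray_def by blast
  qed
  from this[of w c] this[of "inverse w" "inverse c"] show ?thesis by auto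
qed

lemma phase_eq_iff_mem_ray:
  assumes "norm c = 1"
  shows "f z \<noteq> 0 \<and> phase f z = c \<longleftrightarrow> f z \<in> ray c"
proof
  assume "f z \<noteq> 0 \<and> phase f z = c"
  then have "f z = of_real (norm (f z)) * c" "norm (f z) > 0"
    by (auto simp: phase_def)
  then show "f z \<in> ray c" unfolding ray_def by blast
next
  assume "f z \<in> ray c"
  then obtain t where "t > 0" "f z = of_real t * c" by (auto simp: ray_def)
  then show "f z \<noteq> 0 \<and> phase f z = c"
    using assms by (auto simp: phase_def norm_mult)
qed

lemma eq_if_mem_ray_norm_eq:
  assumes "v \<in> ray c" "w \<in> ray c" "norm v = norm w"
  shows "v = w"
  using assms by (auto simp: ray_def norm_mult)

lemma isochromatic_lines_eq:
  assumes "norm c = 1"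
  shows "isochromatic_lines f U c = components {z \<in> U. deriv f z \<noteq> 0 \<and> f z \<in> ray c}"
  unfolding isochromatic_lines_def
  by (rule arg_cong[where f = components]) (use phase_eq_iff_mem_ray[OF assms, of f] in auto)

section \<open>Local structure of ray preimages\<close>

text \<open>Each component that meets \<open>V\<close> contains a point of some member of
  \<open>K\<close>; this member is connected, so it lies in the component and determines it.\<close>

lemma finite_components_meeting:
  assumes "finite K" and con: "\<And>T. T \<in> K \<Longrightarrow> connected T" and un: "\<Union>K = S \<inter> V"
  shows "finite {L \<in> components S. L \<inter> V \<noteq> {}}"
proof (rule finite_subset)
  \<comment> \<open>A chosen point of \<open>T\<close> names its component; an empty
    \<open>T\<close> only adds a harmless set to the finite image.\<close>
  show "{L \<in> components S. L \<inter> V \<noteq> {}}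
      \<subseteq> (\<lambda>T. connected_component_set S (SOME x. x \<in> T)) ` K"
  proof clarify
    fix L x assume L: "L \<in> components S" and "L \<inter> V \<noteq> {}"
    then obtain x where x: "x \<in> L" "x \<in> V" by auto
    with L un in_components_subset obtain T where T: "T \<in> K" "x \<in> T" by blast
    then have "T \<subseteq> S" using un by blast
    then have "T \<subseteq> L"
      using T x components_maximal[OF L con[OF T(1)]] by blast
    moreover have "(SOME x. x \<in> T) \<in> T" using someI[of "\<lambda>x. x \<in> T", OF T(2)] .
    ultimately have "L = connected_component_set S (SOME x. x \<in> T)"
      using L by (metis (no_types, lifting) components_iff connected_component_eq subsetD)
    then show "L \<in> (\<lambda>T. connected_component_set S (SOME x. x \<in> T)) ` K"
      using T(1) by blast
  qed
qed (use assms in simp)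

text \<open>Near \<open>\<xi>\<close>, \<open>g z - g \<xi>\<close> equals \<open>h z ^ n\<close>
  for a conformal \<open>h\<close> vanishing at \<open>\<xi>\<close>. The inverse \<open>k\<close>
  of \<open>h\<close> carries the segments in the directions \<open>\<omega>\<close> with
  \<open>\<omega> ^ n = c\<close> onto the preimage of \<open>ray c\<close>. One \<open>V\<close>
  serves all \<open>c\<close>, so that opposite rays can be combined; \<open>W\<close> lets
  \<open>V\<close> be taken small.\<close>

lemma finite_connected_ray_preimages_near_point:
  assumes holg: "g holomorphic_on S" and S: "open S" "connected S" "\<xi> \<in> S"
    and nc: "\<not> g constant_on S" and W: "open W" "\<xi> \<in> W"
  obtains V where "open V" "\<xi> \<in> V" "V \<subseteq> S \<inter> W"
    "\<And>z. z \<in> V - {\<xi>} \<Longrightarrow> g z \<noteq> g \<xi> \<and> deriv g z \<noteq> 0"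
    "\<And>c. \<exists>K. finite K \<and> (\<forall>T\<in>K. connected T) \<and> \<Union>K = {z \<in> V - {\<xi>}. g z - g \<xi> \<in> ray c}"
proof -
  \<comment> \<open>By the identity theorem some derivative survives at \<open>\<xi>\<close>; the
    least such \<open>n\<close> is the order of the zero of \<open>g z - g \<xi>\<close>.\<close>
  have "\<exists>n>0. (deriv ^^ n) g \<xi> \<noteq> 0"
    using holomorphic_fun_eq_const_on_connected[OF holg S(1,2) _ S(3)] nc
    unfolding constant_on_def by blast
  then obtain n where n: "n > 0" "(deriv ^^ n) g \<xi> \<noteq> 0"
    and nmin: "\<And>i. 0 < i \<Longrightarrow> i < n \<Longrightarrow> (deriv ^^ i) g \<xi> = 0"
    using exists_least_iff[of "\<lambda>n. n > 0 \<and> (deriv ^^ n) g \<xi> \<noteq> 0"] by auto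
  obtain G r where "r > 0" and holG: "G holomorphic_on ball \<xi> r"
    and fac: "\<And>w. w \<in> ball \<xi> r \<Longrightarrow> g w - g \<xi> = ((w - \<xi>) * G w) ^ n"
    and G0: "\<And>w. w \<in> ball \<xi> r \<Longrightarrow> G w \<noteq> 0"
    using holomorphic_factor_order_of_zero_strong[OF holg S(1,3) n nmin] by metis
  define h where "h = (\<lambda>w. (w - \<xi>) * G w)"
  define B where "B = ball \<xi> r \<inter> S \<inter> W"
  have B: "open B" "\<xi> \<in> B" using S W \<open>r > 0\<close> by (auto simp: B_def)
  have holh: "h holomorphic_on B"
    unfolding h_def by (intro holomorphic_intros holomorphic_on_subset[OF holG]) (auto simp: B_def)
  have "(h has_field_derivative G \<xi>) (at \<xi>)"
  proof -
    have "(G has_field_derivative deriv G \<xi>) (at \<xi>)"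
      using holG \<open>r > 0\<close> by (intro holomorphic_derivI[OF holG]) auto
    then show ?thesis
      unfolding h_def by (auto intro!: derivative_eq_intros)
  qed
  then have "deriv h \<xi> \<noteq> 0"
    using G0[of \<xi>] \<open>r > 0\<close> DERIV_imp_deriv by fastforce
  then obtain \<rho> where \<rho>: "\<rho> > 0" "ball \<xi> \<rho> \<subseteq> B" "open (h ` ball \<xi> \<rho>)" "inj_on h (ball \<xi> \<rho>)"
    using has_complex_derivative_locally_invertible[OF holh B(2,1)] by blast
  have holh': "h holomorphic_on ball \<xi> \<rho>"
    using holh \<rho>(2) by (rule holomorphic_on_subset)
  obtain k where holk: "k holomorphic_on h ` ball \<xi> \<rho>"
    and dk: "\<And>z. z \<in> ball \<xi> \<rho> \<Longrightarrow> deriv h z * deriv k (h z) = 1"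
    and kh: "\<And>z. z \<in> ball \<xi> \<rho> \<Longrightarrow> k (h z) = z"
    by (rule holomorphic_has_inverse[OF holh' open_ball \<rho>(4)], rule that)
  have "h \<xi> = 0" by (simp add: h_def)
  then have "0 \<in> h ` ball \<xi> \<rho>" using \<rho>(1) by (metis centre_in_ball image_eqI)
  then obtain \<delta> where \<delta>: "\<delta> > 0" "ball 0 \<delta> \<subseteq> h ` ball \<xi> \<rho>"
    using \<rho>(3) open_contains_ball by blast
  \<comment> \<open>On this \<open>V\<close>, \<open>h\<close> is a bijection onto
    \<open>ball 0 \<delta>\<close>.\<close>
  define V where "V = ball \<xi> \<rho> \<inter> h -` ball 0 \<delta>"
  have Vb: "z \<in> ball \<xi> r" "z \<in> ball \<xi> \<rho>" if "z \<in> V" for z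
    using that \<rho>(2) by (auto simp: V_def B_def)
  have h0: "h z \<noteq> 0" if "z \<in> V - {\<xi>}" for z
    using that G0[of z] Vb[of z] by (auto simp: h_def)
  have gh: "g z = g \<xi> + h z ^ n" if "z \<in> ball \<xi> r" for z
    using fac[OF that] by (simp add: h_def algebra_simps)
  show ?thesis
  proof
    show "open V" unfolding V_def
      by (intro continuous_open_preimage holomorphic_on_imp_continuous_on holh') auto
    show "\<xi> \<in> V" using \<rho> \<delta> \<open>h \<xi> = 0\<close> by (simp add: V_def)
    show "V \<subseteq> S \<inter> W" using \<rho>(2) by (auto simp: V_def B_def)
  next
    fix z assume z: "z \<in> V - {\<xi>}"
    have "(h has_field_derivative deriv h z) (at z)"
      using z Vb by (intro holomorphic_derivI[OF holh']) auto
    then have "((\<lambda>w. g \<xi> + h w ^ n) has_field_derivative of_nat n * h z ^ (n - 1) * deriv h z) (at z)"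
      by (auto intro!: derivative_eq_intros)
    then have "(g has_field_derivative of_nat n * h z ^ (n - 1) * deriv h z) (at z)"
      by (rule has_field_derivative_transform_within_open[where S = "ball \<xi> r"])
        (use gh z Vb in auto)
    moreover have "deriv h z \<noteq> 0" using dk[of z] z Vb by force
    ultimately show "g z \<noteq> g \<xi> \<and> deriv g z \<noteq> 0"
      using h0[OF z] n(1) gh[of z] z Vb(1)[of z] by (auto dest!: DERIV_imp_deriv)
  next
    fix c :: complex
    \<comment> \<open>Excluding \<open>\<omega> = 0\<close> covers \<open>c = 0\<close>: then
      \<open>ray c\<close> is \<open>{0}\<close>, its preimage in \<open>V - {\<xi>}\<close> is
      empty, and so is \<open>K\<close>.\<close>
    define K where "K = (\<lambda>\<omega>. k ` (ball 0 \<delta> \<inter> ray \<omega>)) ` {\<omega>. \<omega> ^ n = c \<and> \<omega> \<noteq> 0}"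
    have "finite K"
      unfolding K_def using n(1) by (auto intro!: finite_imageI intro: finite_subset[OF _ finite_nth_roots[of n c]])
    moreover have "connected T" if T: "T \<in> K" for T
    proof -
      obtain \<omega> where "T = k ` (ball 0 \<delta> \<inter> ray \<omega>)" using T K_def by blast
      then show ?thesis
        using \<delta>(2) by (auto intro!: connected_continuous_image[OF _ convex_connected] convex_Int convex_ray
          holomorphic_on_imp_continuous_on holomorphic_on_subset[OF holk])
    qed
    moreover have "\<Union>K = {z \<in> V - {\<xi>}. g z - g \<xi> \<in> ray c}"
    proof (intro equalityI subsetI)
      fix z assume "z \<in> \<Union>K"
      then obtain \<omega> t where \<omega>: "\<omega> ^ n = c" "\<omega> \<noteq> 0" and t: "t > 0" "of_real t * \<omega> \<in> ball 0 \<delta>"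
        and z: "z = k (of_real t * \<omega>)" by (auto simp: K_def ray_def)
      then obtain z' where z': "z' \<in> ball \<xi> \<rho>" "of_real t * \<omega> = h z'" using \<delta>(2) by blast
      then have "z' = z" using z kh by simp
      then have "z \<in> V" using z' t by (auto simp: V_def)
      moreover have "z \<noteq> \<xi>" using z' \<open>z' = z\<close> \<open>h \<xi> = 0\<close> t \<omega> by auto
      moreover have "g z - g \<xi> = of_real (t ^ n) * c"
        using gh[of z] Vb \<open>z \<in> V\<close> z' \<open>z' = z\<close> \<omega> by (metis add_diff_cancel_left' of_real_power power_mult_distrib)
      ultimately show "z \<in> {z \<in> V - {\<xi>}. g z - g \<xi> \<in> ray c}"
        using t unfolding ray_def by (metis (mono_tags, lifting) CollectI DiffI greaterThan_iff image_eqI singletonD zero_less_power)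
    next
      fix z assume z: "z \<in> {z \<in> V - {\<xi>}. g z - g \<xi> \<in> ray c}"
      then obtain t where t: "t > 0" "g z - g \<xi> = of_real t * c" by (auto simp: ray_def)
      \<comment> \<open>Dividing by the positive root of \<open>t\<close> leaves an
        \<open>n\<close>-th root of \<open>c\<close> and puts \<open>h z\<close> on its ray.\<close>
      define \<omega> where "\<omega> = h z / of_real (root n t)"
      have rt: "root n t > 0" "root n t ^ n = t" using t n by (simp_all add: real_root_pow_pos2)
      have "h z ^ n = of_real t * c" using gh[of z] t z Vb(1)[of z] by simp
      then have "\<omega> ^ n = c"
        using t rt(2) by (simp add: \<omega>_def power_divide flip: of_real_power)
      moreover have "\<omega> \<noteq> 0" using h0[of z] z rt by (simp add: \<omega>_def)
      moreover have "h z \<in> ray \<omega>"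
        unfolding ray_def using rt by (auto simp: \<omega>_def intro!: image_eqI[of _ _ "root n t"])
      moreover have "h z \<in> ball 0 \<delta>" "z = k (h z)" using z kh Vb[of z] by (auto simp: V_def)
      ultimately show "z \<in> \<Union>K" unfolding K_def by blast
    qed
    ultimately show "\<exists>K. finite K \<and> (\<forall>T\<in>K. connected T) \<and> \<Union>K = {z \<in> V - {\<xi>}. g z - g \<xi> \<in> ray c}"
      by blast
  qed
qed

section \<open>Injectivity of \<open>f\<close> on an isochromatic line\<close>

text \<open>Near a noncritical point \<open>f\<close> has a holomorphic inverse, which carries small
  convex pieces of \<open>C\<close> onto relatively open sets of the preimage. This later makes the
  components path connected.\<close>

lemma locally_path_connected_noncritical_preimage:
  assumes holf: "f holomorphic_on U" and "open U" and "convex C"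
  shows "locally path_connected {z \<in> U. deriv f z \<noteq> 0 \<and> f z \<in> C}" (is "locally _ ?S")
  unfolding locally_path_connected
proof clarify
  fix v x assume "openin (top_of_set ?S) v" and x: "x \<in> v"
  then obtain W where W: "open W" "v = ?S \<inter> W" by (auto simp: openin_open)
  \<comment> \<open>\<open>U'\<close> contains no critical points and lies in \<open>W\<close>,
    which keeps the neighbourhood \<open>u\<close> below inside \<open>v\<close>.\<close>
  define U' where "U' = (U \<inter> deriv f -` (- {0})) \<inter> W"
  have "open (U \<inter> deriv f -` (- {0}))"
    using assms by (intro continuous_open_preimage holomorphic_on_imp_continuous_on holomorphic_deriv) auto
  then have U': "open U'" "x \<in> U'" "deriv f x \<noteq> 0" using W x by (auto simp: U'_def)
  have "f holomorphic_on U'" using holf by (rule holomorphic_on_subset) (auto simp: U'_def)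
  then obtain \<rho> where \<rho>: "\<rho> > 0" "ball x \<rho> \<subseteq> U'" "open (f ` ball x \<rho>)" "inj_on f (ball x \<rho>)"
    using has_complex_derivative_locally_invertible[OF _ U'(2,1,3)] by blast
  have holf': "f holomorphic_on ball x \<rho>"
    using holf by (rule holomorphic_on_subset) (use \<rho>(2) U'_def in blast)
  obtain k where holk: "k holomorphic_on f ` ball x \<rho>"
    and "\<And>z. z \<in> ball x \<rho> \<Longrightarrow> deriv f z * deriv k (f z) = 1"
    and kf: "\<And>z. z \<in> ball x \<rho> \<Longrightarrow> k (f z) = z"
    by (rule holomorphic_has_inverse[OF holf' open_ball \<rho>(4)], rule that)
  have "f x \<in> f ` ball x \<rho>" using \<rho>(1) by simp
  then obtain \<delta> where \<delta>: "\<delta> > 0" "ball (f x) \<delta> \<subseteq> f ` ball x \<rho>"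
    using \<rho>(3) open_contains_ball by blast
  define u where "u = ?S \<inter> (ball x \<rho> \<inter> f -` ball (f x) \<delta>)"
  have "u = k ` (ball (f x) \<delta> \<inter> C)"
  proof (intro equalityI subsetI)
    fix z assume "z \<in> u"
    then show "z \<in> k ` (ball (f x) \<delta> \<inter> C)" using kf[of z] by (force simp: u_def)
  next
    fix z assume "z \<in> k ` (ball (f x) \<delta> \<inter> C)"
    then obtain w where w: "w \<in> ball (f x) \<delta>" "w \<in> C" "z = k w" by blast
    then obtain z' where "z' \<in> ball x \<rho>" "w = f z'" using \<delta>(2) by blast
    then show "z \<in> u" using w kf[of z'] \<rho>(2) by (auto simp: u_def U'_def)
  qed
  then have "path_connected u"
    using \<delta>(2) assms(3)
    by (auto intro!: path_connected_continuous_image[OF _ convex_imp_path_connected] convex_Int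
        holomorphic_on_imp_continuous_on holomorphic_on_subset[OF holk])
  moreover have "openin (top_of_set ?S) u"
    unfolding u_def
    by (intro openin_open_Int continuous_open_preimage holomorphic_on_imp_continuous_on holf') auto
  moreover have "x \<in> u" using x W \<rho> \<delta> by (auto simp: u_def)
  moreover have "u \<subseteq> v" using \<rho>(2) W by (auto simp: u_def U'_def)
  ultimately show "\<exists>u. openin (top_of_set ?S) u \<and> path_connected u \<and> x \<in> u \<and> u \<subseteq> v"
    by blast
qed

text \<open>Rolle's argument without derivatives: if a maximum and a minimum both sit at endpoints,
  the function is constant and the midpoint serves.\<close>

lemma interior_extremum_if_eq_endpoints:
  fixes \<phi> :: "real \<Rightarrow> real"
  assumes "a < b" "continuous_on {a..b} \<phi>" "\<phi> a = \<phi> b"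
  obtains t where "a < t" "t < b"
    "(\<forall>s\<in>{a..b}. \<phi> s \<le> \<phi> t) \<or> (\<forall>s\<in>{a..b}. \<phi> t \<le> \<phi> s)"
proof -
  obtain M where M: "M \<in> {a..b}" "\<forall>s\<in>{a..b}. \<phi> s \<le> \<phi> M"
    using continuous_attains_sup[of "{a..b}" \<phi>] assms by auto
  obtain m where m: "m \<in> {a..b}" "\<forall>s\<in>{a..b}. \<phi> m \<le> \<phi> s"
    using continuous_attains_inf[of "{a..b}" \<phi>] assms by auto
  show ?thesis
  proof (cases "M \<in> {a<..<b} \<or> m \<in> {a<..<b}")
    case True
    then show ?thesis using M m that by auto
  next
    case False
    then have "M = a \<or> M = b" "m = a \<or> m = b" using M(1) m(1) by auto
    then have "\<phi> M = \<phi> m" using assms(3) by auto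
    then have "\<phi> s \<le> \<phi> ((a + b) / 2)" if "s \<in> {a..b}" for s
      using bspec[OF M(2) that] bspec[OF m(2), of "(a + b) / 2"] assms(1) by simp
    then show ?thesis using that[of "(a + b) / 2"] assms(1) by auto
  qed
qed

text \<open>An arc in a line joining two points with the same value of \<^term>\<open>f\<close> would carry an interior
  extremum of \<^term>\<open>norm \<circ> f\<close>, which is impossible since \<^term>\<open>norm \<circ> f\<close> is locally injective on it.\<close>

lemma inj_on_noncritical_ray_preimage_component:
  assumes holf: "f holomorphic_on U" and "open U"
    and L: "L \<in> components {z \<in> U. deriv f z \<noteq> 0 \<and> f z \<in> ray c}" (is "_ \<in> components ?S")
  shows "inj_on f L"
proof (rule inj_onI, rule ccontr)
  fix p q assume pq: "p \<in> L" "q \<in> L" "f p = f q" "p \<noteq> q"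
  have LS: "L \<subseteq> ?S" using L by (rule in_components_subset)
  \<comment> \<open>Local path connectedness passes to components, so the connected set
    \<open>L\<close> is path connected and an arc within it joins \<open>p\<close> to
    \<open>q\<close>.\<close>
  have "locally path_connected L"
    using locally_path_connected_components[OF locally_path_connected_noncritical_preimage L] assms convex_ray
    by blast
  then have "path_connected L"
    using connected_component_eq_self[OF in_components_connected[OF L]]
      path_connected_component_set path_component_eq_connected_component_set
      pq(1) by (metis path_connected_path_component)
  then obtain g where g: "arc g" "path_image g \<subseteq> L" "pathstart g = p" "pathfinish g = q"
    using pq unfolding path_connected_arcwise by blast
  have contg: "continuous_on {0..1} g" and injg: "inj_on g {0..1}"
    using g(1) by (auto simp: arc_def path_def)
  have gS: "g t \<in> ?S" if "t \<in> {0..1}" for t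
    using that g(2) LS unfolding path_image_def by blast
  define \<phi> where "\<phi> = (\<lambda>t. norm (f (g t)))"
  have cont\<phi>: "continuous_on {0..1} \<phi>"
    unfolding \<phi>_def
    by (intro continuous_on_norm continuous_on_compose2[OF holomorphic_on_imp_continuous_on[OF holf] contg])
      (use gS in auto)
  have "\<phi> 0 = \<phi> 1" using g(3,4) pq(3) by (simp add: \<phi>_def pathstart_def pathfinish_def)
  then obtain t where t: "0 < t" "t < 1"
    and ext: "(\<forall>s\<in>{0..1}. \<phi> s \<le> \<phi> t) \<or> (\<forall>s\<in>{0..1}. \<phi> t \<le> \<phi> s)"
    using interior_extremum_if_eq_endpoints[of 0 1 \<phi>] cont\<phi> by auto
  have "g t \<in> U" "deriv f (g t) \<noteq> 0" using gS[of t] t by auto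
  then obtain \<rho> where \<rho>: "\<rho> > 0" "inj_on f (ball (g t) \<rho>)"
    using has_complex_derivative_locally_injective[OF holf _ \<open>open U\<close>] by metis
  obtain d where d: "d > 0" "\<And>s. s \<in> {0..1} \<Longrightarrow> dist s t < d \<Longrightarrow> dist (g s) (g t) < \<rho>"
    using contg t \<rho>(1) unfolding continuous_on_iff by (metis atLeastAtMost_iff less_eq_real_def)
  \<comment> \<open>The interval of radius \<open>\<epsilon>\<close> about \<open>t\<close> stays in
    \<open>{0..1}\<close>, and \<open>g\<close> maps it into the ball on which \<open>f\<close> is
    injective; halving \<open>d\<close> makes \<open>\<epsilon> < d\<close> strict.\<close>
  define \<epsilon> where "\<epsilon> = Min {d / 2, t, 1 - t}"
  have \<epsilon>: "\<epsilon> > 0" "\<epsilon> < d" "\<epsilon> \<le> t" "\<epsilon> \<le> 1 - t"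
    using t d(1) by (auto simp: \<epsilon>_def min_def)
  have sub: "{t - \<epsilon>..t + \<epsilon>} \<subseteq> {0..1}" using \<epsilon> by auto
  \<comment> \<open>On a ray the modulus determines the point, so equal values of
    \<open>\<phi>\<close> give equal values of \<open>f\<close>, hence of \<open>g\<close>, hence
    equal parameters.\<close>
  have "inj_on \<phi> {t - \<epsilon>..t + \<epsilon>}"
  proof (rule inj_onI)
    fix s s' assume s: "s \<in> {t - \<epsilon>..t + \<epsilon>}" "s' \<in> {t - \<epsilon>..t + \<epsilon>}" and eq: "\<phi> s = \<phi> s'"
    then have s01: "s \<in> {0..1}" "s' \<in> {0..1}" using sub by blast+
    then have "f (g s) = f (g s')"
      using eq gS by (intro eq_if_mem_ray_norm_eq[of _ c]) (auto simp: \<phi>_def)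
    moreover have "g s \<in> ball (g t) \<rho>" "g s' \<in> ball (g t) \<rho>"
      using d(2)[OF s01(1)] d(2)[OF s01(2)] s \<epsilon> by (auto simp: dist_commute dist_real_def)
    ultimately have "g s = g s'" using \<rho>(2) by (auto dest: inj_onD)
    then show "s = s'" using injg s01 by (auto dest: inj_onD)
  qed
  \<comment> \<open>A continuous injective real function on an interval is strictly monotone, so
    \<open>\<phi> t\<close> cannot be extremal.\<close>
  then have "(\<phi> (t - \<epsilon>) < \<phi> t \<and> \<phi> t < \<phi> (t + \<epsilon>)) \<or> (\<phi> (t + \<epsilon>) < \<phi> t \<and> \<phi> t < \<phi> (t - \<epsilon>))"
    using \<epsilon>(1) continuous_on_subset[OF cont\<phi> sub] by (intro continuous_inj_imp_mono) auto
  moreover have "t - \<epsilon> \<in> {0..1}" "t + \<epsilon> \<in> {0..1}" using \<epsilon> t by auto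
  ultimately show False using ext by (metis not_less)
qed

section \<open>Finiteness at removable singularities and poles\<close>

text \<open>A constant extension has no lines, and a non-zero limit off the ray keeps colour
  \<open>c\<close> away from \<open>z0\<close>. If \<open>a = 0\<close> the local structure applies
  directly; if \<open>a\<close> is on the ray, it applies to the two opposite rays issuing from
  \<open>a\<close>.\<close>

lemma finite_components_near_removable_singularity:
  assumes "r > 0" and holf: "f holomorphic_on ball z0 r - {z0}" and lim: "f \<midarrow>z0\<rightarrow> a"
    and c: "norm c = 1"
  defines "S \<equiv> {z \<in> ball z0 r - {z0}. deriv f z \<noteq> 0 \<and> f z \<in> ray c}"
  obtains V where "open V" "z0 \<in> V" "finite {L \<in> components S. L \<inter> V \<noteq> {}}"
proof -
  \<comment> \<open>\<open>f z0\<close> may differ from the limit; \<open>g\<close> is the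
    holomorphic extension.\<close>
  define g where "g = (\<lambda>z. if z = z0 then a else f z)"
  have holg: "g holomorphic_on ball z0 r"
    unfolding g_def using removable_singularity[OF holf _ lim] by simp
  have dg: "deriv g z = deriv f z" if "z \<in> ball z0 r - {z0}" for z
  proof (rule deriv_cong_ev)
    show "\<forall>\<^sub>F w in nhds z. g w = f w"
      using that by (intro eventually_nhds_in_open[THEN eventually_mono, of "- {z0}"]) (auto simp: g_def)
  qed simp
  have z0: "z0 \<in> ball z0 r" using \<open>r > 0\<close> by simp
  then have contg: "isCont g z0"
    using holg by (meson continuous_on_eq_continuous_at holomorphic_on_imp_continuous_on open_ball)
  \<comment> \<open>No point of \<open>V - {z0}\<close> is critical, so within \<open>V\<close> the
    set \<open>S\<close> is just a ray preimage.\<close>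
  have SV: "S \<inter> V = {z \<in> V - {z0}. f z \<in> ray c}"
    if V: "V \<subseteq> ball z0 r \<inter> W" "\<And>z. z \<in> V - {z0} \<Longrightarrow> g z \<noteq> g z0 \<and> deriv g z \<noteq> 0" for V W
  proof -
    have "z \<in> S \<longleftrightarrow> f z \<in> ray c" if "z \<in> V - {z0}" for z
      using V(1) V(2)[OF that] dg[of z] that unfolding S_def by force
    then show ?thesis by (auto simp: S_def)
  qed
  consider (const) "g constant_on ball z0 r" | (off) "a \<noteq> 0" "a \<notin> ray c"
    | (zero) "\<not> g constant_on ball z0 r" "a = 0" | (on) "\<not> g constant_on ball z0 r" "a \<in> ray c"
    by blast
  then show ?thesis
  proof cases
    case const
    then obtain b where b: "\<And>z. z \<in> ball z0 r \<Longrightarrow> g z = b" by (auto simp: constant_on_def)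
    have "deriv g z = 0" if "z \<in> ball z0 r" for z
    proof -
      have "deriv g z = deriv (\<lambda>_. b) z"
        using that b by (intro deriv_cong_ev eventually_nhds_in_open[THEN eventually_mono, of "ball z0 r"]) auto
      then show ?thesis by simp
    qed
    then have "S = {}" using dg by (auto simp: S_def)
    then show ?thesis using that[of UNIV] by simp
  next
    case off
    \<comment> \<open>The phase converges to a colour other than \<open>c\<close>, so near
      \<open>z0\<close> the set \<open>S\<close> is empty.\<close>
    have "((\<lambda>z. phase f z) \<longlongrightarrow> a / of_real (norm a)) (at z0)"
      unfolding phase_def using lim off by (auto intro!: tendsto_intros)
    moreover have "a / of_real (norm a) \<noteq> c"
      using off phase_eq_iff_mem_ray[OF c, of "\<lambda>_. a"] by (auto simp: phase_def)
    ultimately have "\<forall>\<^sub>F z in at z0. phase f z \<noteq> c" by (rule tendsto_imp_eventually_ne)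
    then obtain V where V: "open V" "z0 \<in> V" "\<And>z. z \<in> V \<Longrightarrow> z \<noteq> z0 \<Longrightarrow> phase f z \<noteq> c"
      unfolding eventually_at_topological by blast
    have "\<Union>{} = S \<inter> V" using V(3) phase_eq_iff_mem_ray[OF c, of f] by (auto simp: S_def)
    then have "finite {L \<in> components S. L \<inter> V \<noteq> {}}"
      using finite_components_meeting[of "{}" S V] by simp
    then show ?thesis using that V by blast
  next
    case zero
    obtain V where V: "open V" "z0 \<in> V" "V \<subseteq> ball z0 r \<inter> UNIV"
      "\<And>z. z \<in> V - {z0} \<Longrightarrow> g z \<noteq> g z0 \<and> deriv g z \<noteq> 0"
      and VK: "\<And>c. \<exists>K. finite K \<and> (\<forall>T\<in>K. connected T) \<and> \<Union>K = {z \<in> V - {z0}. g z - g z0 \<in> ray c}"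
      by (rule finite_connected_ray_preimages_near_point
          [OF holg open_ball connected_ball z0 zero(1) open_UNIV UNIV_I], rule that)
    obtain K where K: "finite K" "\<forall>T\<in>K. connected T" "\<Union>K = {z \<in> V - {z0}. g z - g z0 \<in> ray c}"
      using VK[of c] by (elim exE conjE) (rule that)
    have "\<Union>K = {z \<in> V - {z0}. f z \<in> ray c}"
      unfolding K(3) using zero(2) by (auto simp: g_def)
    then have "\<Union>K = S \<inter> V" using SV[OF V(3,4)] by simp
    then show ?thesis using that[OF V(1,2)] finite_components_meeting[of K S V] K by blast
  next
    case on
    then obtain t where t: "t > 0" "a = of_real t * c" by (auto simp: ray_def)
    \<comment> \<open>Here \<open>t\<close> is the modulus of \<open>a\<close>: within distance
      \<open>t\<close> of \<open>a\<close>, the real line through 0 and \<open>c\<close> contains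
      only points of \<open>ray c\<close>.\<close>
    have "\<forall>\<^sub>F z in nhds z0. dist (g z) (g z0) < t"
      using contg t by (simp add: isCont_def tendsto_at_iff_tendsto_nhds tendstoD)
    then obtain W where W: "open W" "z0 \<in> W" "\<And>z. z \<in> W \<Longrightarrow> dist (g z) (g z0) < t"
      unfolding eventually_nhds by blast
    obtain V where V: "open V" "z0 \<in> V" "V \<subseteq> ball z0 r \<inter> W"
      "\<And>z. z \<in> V - {z0} \<Longrightarrow> g z \<noteq> g z0 \<and> deriv g z \<noteq> 0"
      and VK: "\<And>c. \<exists>K. finite K \<and> (\<forall>T\<in>K. connected T) \<and> \<Union>K = {z \<in> V - {z0}. g z - g z0 \<in> ray c}"
      by (rule finite_connected_ray_preimages_near_point
          [OF holg open_ball connected_ball z0 on(1) W(1,2)], rule that)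
    obtain K where K: "finite K" "\<forall>T\<in>K. connected T" "\<Union>K = {z \<in> V - {z0}. g z - g z0 \<in> ray c}"
      using VK[of c] by (elim exE conjE) (rule that)
    obtain K' where K': "finite K'" "\<forall>T\<in>K'. connected T" "\<Union>K' = {z \<in> V - {z0}. g z - g z0 \<in> ray (- c)}"
      using VK[of "- c"] by (elim exE conjE) (rule that)
    \<comment> \<open>Seen from \<open>a\<close>, the ray runs in the two directions
      \<open>c\<close> and \<open>- c\<close>; the point \<open>a\<close> itself is not a value of
      \<open>g\<close> on \<open>V - {z0}\<close>.\<close>
    have ray_iff: "f z \<in> ray c \<longleftrightarrow> g z - g z0 \<in> ray c \<or> g z - g z0 \<in> ray (- c)"
      if z: "z \<in> V - {z0}" for z
    proof
      assume "f z \<in> ray c"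
      then obtain s where s: "s > 0" "f z = of_real s * c" by (auto simp: ray_def)
      then have "g z - g z0 = of_real (s - t) * c" "g z - g z0 = of_real (t - s) * (- c)"
        using z t by (auto simp: g_def algebra_simps)
      moreover have "s \<noteq> t" using s t V(4)[OF z] z by (auto simp: g_def)
      ultimately show "g z - g z0 \<in> ray c \<or> g z - g z0 \<in> ray (- c)"
        unfolding ray_def by (metis diff_gt_0_iff_gt greaterThan_iff image_eqI linorder_neqE_linordered_idom)
    next
      assume "g z - g z0 \<in> ray c \<or> g z - g z0 \<in> ray (- c)"
      then obtain s where s: "g z - g z0 = of_real s * c"
        unfolding ray_def by (metis (no_types, lifting) imageE minus_mult_commute of_real_minus)
      have "norm (g z - g z0) < t" using W(3)[of z] V(3) z by (auto simp: dist_norm)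
      then have "\<bar>s\<bar> < t" using s c by (simp add: norm_mult)
      moreover have "f z = of_real (t + s) * c" using s t z by (auto simp: g_def algebra_simps)
      ultimately show "f z \<in> ray c" unfolding ray_def by (intro image_eqI[of _ _ "t + s"]) auto
    qed
    have "\<Union>(K \<union> K') = S \<inter> V"
    proof -
      have "\<Union>(K \<union> K') = {z \<in> V - {z0}. f z \<in> ray c}"
        using K(3) K'(3) ray_iff by auto
      also have "\<dots> = S \<inter> V" using SV[OF V(3,4)] by simp
      finally show ?thesis .
    qed
    then show ?thesis using that[OF V(1,2)] finite_components_meeting[of "K \<union> K'" S V] K K' by blast
  qed
qed

text \<open>Near \<open>z0\<close>, \<open>1 / f\<close> extends to a holomorphic \<open>g\<close>
  whose only zero is \<open>z0\<close>, hence non-constant, and inversion turns \<open>ray c\<close>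
  into \<open>ray (inverse c)\<close>.\<close>

lemma finite_components_near_pole:
  fixes c :: complex
  assumes "r > 0" and holf: "f holomorphic_on ball z0 r - {z0}"
    and lim: "filterlim f at_infinity (at z0)"
  defines "S \<equiv> {z \<in> ball z0 r - {z0}. deriv f z \<noteq> 0 \<and> f z \<in> ray c}"
  obtains V where "open V" "z0 \<in> V" "finite {L \<in> components S. L \<inter> V \<noteq> {}}"
proof -
  have "\<forall>\<^sub>F z in at z0. f z \<noteq> 0"
    using lim by (rule filterlim_at_infinity_imp_eventually_ne)
  then obtain d where d: "d > 0" "\<And>z. z \<noteq> z0 \<Longrightarrow> dist z z0 < d \<Longrightarrow> f z \<noteq> 0"
    unfolding eventually_at by auto
  define e where "e = min d r"
  have e: "e > 0" "e \<le> r" using d \<open>r > 0\<close> by (auto simp: e_def)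
  have f0: "f z \<noteq> 0" if "z \<in> ball z0 e - {z0}" for z
    using that d(2)[of z] by (auto simp: e_def dist_commute)
  define g where "g = (\<lambda>z. if z = z0 then 0 else inverse (f z))"
  have "(\<lambda>z. inverse (f z)) holomorphic_on ball z0 e - {z0}"
    using f0 e by (intro holomorphic_intros holomorphic_on_subset[OF holf]) auto
  moreover have "(\<lambda>z. inverse (f z)) \<midarrow>z0\<rightarrow> 0"
    using lim tendsto_inverse_0 by (rule filterlim_compose[rotated])
  ultimately have holg: "g holomorphic_on ball z0 e"
    unfolding g_def by (rule removable_singularity[OF _ open_ball])
  have z0: "z0 \<in> ball z0 e" using e by simp
  have nc: "\<not> g constant_on ball z0 e"
  proof
    assume "g constant_on ball z0 e"
    moreover have "z0 + of_real (e / 2) \<in> ball z0 e - {z0}" using e by (auto simp: dist_norm)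
    ultimately have "g (z0 + of_real (e / 2)) = g z0"
      using e(1) unfolding constant_on_def by (metis DiffD1 centre_in_ball)
    then show False using f0[OF \<open>z0 + of_real (e / 2) \<in> _\<close>] e by (simp add: g_def)
  qed
  obtain V where V: "open V" "z0 \<in> V" "V \<subseteq> ball z0 e \<inter> UNIV"
    "\<And>z. z \<in> V - {z0} \<Longrightarrow> g z \<noteq> g z0 \<and> deriv g z \<noteq> 0"
    and VK: "\<And>c. \<exists>K. finite K \<and> (\<forall>T\<in>K. connected T) \<and> \<Union>K = {z \<in> V - {z0}. g z - g z0 \<in> ray c}"
    by (rule finite_connected_ray_preimages_near_point
        [OF holg open_ball connected_ball z0 nc open_UNIV UNIV_I], rule that)
  obtain K where K: "finite K" "\<forall>T\<in>K. connected T"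
    "\<Union>K = {z \<in> V - {z0}. g z - g z0 \<in> ray (inverse c)}"
    using VK[of "inverse c"] by (elim exE conjE) (rule that)
  \<comment> \<open>A critical point of \<open>f\<close> would be one of \<open>1 / f\<close>, which
    has none in \<open>V - {z0}\<close>.\<close>
  have df: "deriv f z \<noteq> 0" if z: "z \<in> V - {z0}" for z
  proof
    assume 0: "deriv f z = 0"
    have ze: "z \<in> ball z0 e - {z0}" using z V(3) by blast
    then have "(f has_field_derivative deriv f z) (at z)"
      using e by (intro holomorphic_derivI[OF holf]) auto
    then have "((\<lambda>w. inverse (f w)) has_field_derivative 0) (at z)"
      using f0[OF ze] 0 by (auto intro!: derivative_eq_intros)
    then have "(g has_field_derivative 0) (at z)"
      by (rule has_field_derivative_transform_within_open[where S = "ball z0 e - {z0}"])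
        (use ze in \<open>auto simp: g_def\<close>)
    then show False using V(4)[OF z] DERIV_imp_deriv by blast
  qed
  have "\<Union>K = {z \<in> V - {z0}. f z \<in> ray c}"
    unfolding K(3) using mem_ray_inverse_iff[of _ c] by (auto simp: g_def)
  also have "\<dots> = S \<inter> V"
    using V(3) df e(2) by (auto simp: S_def)
  finally show ?thesis
    using that[OF V(1,2)] finite_components_meeting[of K S V] K by blast
qed

section \<open>Infinitely many lines at an essential singularity\<close>

text \<open>Its contrapositive gives the hypothesis on \<open>inverse \<circ> f\<close> in Picard's
  great theorem. A limit \<open>l \<noteq> 0\<close> inverts to a limit of \<open>f\<close>; for
  \<open>l = 0\<close>, \<open>f\<close> either vanishes identically near \<open>z0\<close> or has a
  pole.\<close>

lemma tendsto_or_pole_if_inverse_tendsto: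
  assumes "r > 0" and holf: "f holomorphic_on ball z0 r - {z0}"
    and lim: "(\<lambda>z. inverse (f z)) \<midarrow>z0\<rightarrow> l"
  shows "(\<exists>a. f \<midarrow>z0\<rightarrow> a) \<or> filterlim f at_infinity (at z0)"
proof (cases "l = 0")
  case False
  then show ?thesis using tendsto_inverse[OF lim] by auto
next
  case True
  then have "\<forall>\<^sub>F z in at z0. norm (inverse (f z)) < 1"
    using tendstoD[OF lim, of 1] by simp
  then obtain d where d: "d > 0" "\<And>z. z \<noteq> z0 \<Longrightarrow> dist z z0 < d \<Longrightarrow> norm (inverse (f z)) < 1"
    unfolding eventually_at by auto
  define e where "e = min d r"
  have e: "e > 0" "e \<le> r" using d \<open>r > 0\<close> by (auto simp: e_def)
  let ?B = "ball z0 e - {z0}"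
  \<comment> \<open>The modulus of \<open>f\<close> thus skips all values in the interval from 0
    (exclusive) to 1 (inclusive).\<close>
  have gap: "f z = 0 \<or> norm (f z) > 1" if "z \<in> ?B" for z
    using that d(2)[of z] by (auto simp: e_def dist_commute norm_inverse inverse_less_1_iff)
  have evB: "\<forall>\<^sub>F z in at z0. z \<in> ?B"
    using eventually_at_in_open[of "ball z0 e" z0] e by simp
  have "continuous_on ?B (\<lambda>z. norm (f z))"
    using e by (intro continuous_on_norm holomorphic_on_imp_continuous_on holomorphic_on_subset[OF holf]) auto
  moreover have "connected ?B" by (rule connected_punctured_ball) simp
  ultimately have con: "connected ((\<lambda>z. norm (f z)) ` ?B)"
    by (rule connected_continuous_image)
  \<comment> \<open>Since \<open>inverse 0 = 0\<close>, the limit alone does not exclude zeros of \<open>f\<close> accumulating at \<open>z0\<close>.\<close>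
  have "(\<forall>z\<in>?B. f z = 0) \<or> (\<forall>z\<in>?B. f z \<noteq> 0)"
  proof (rule ccontr)
    assume "\<not> ?thesis"
    then obtain x y where xy: "x \<in> ?B" "y \<in> ?B" "f x = 0" "f y \<noteq> 0" by blast
    then have "norm (f x) \<le> 1" "1 \<le> norm (f y)" using gap[of y] by auto
    then have "1 \<in> (\<lambda>z. norm (f z)) ` ?B"
      using connectedD_interval[OF con, of "norm (f x)" "norm (f y)" 1] xy by blast
    then obtain z where "1 = norm (f z)" "z \<in> ?B" by (elim imageE) (rule that)
    then show False using gap[of z] by auto
  qed
  then show ?thesis
  proof
    assume "\<forall>z\<in>?B. f z = 0"
    then have "\<forall>\<^sub>F z in at z0. f z = 0"
      using eventually_mono[OF evB, of "\<lambda>z. f z = 0"] by auto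
    then have "f \<midarrow>z0\<rightarrow> 0" by (rule tendsto_eventually)
    then show ?thesis by blast
  next
    assume "\<forall>z\<in>?B. f z \<noteq> 0"
    then have "\<forall>\<^sub>F z in at z0. inverse (f z) \<noteq> 0"
      using eventually_mono[OF evB, of "\<lambda>z. inverse (f z) \<noteq> 0"] by auto
    then have "filterlim (\<lambda>z. inverse (f z)) (at 0) (at z0)"
      using lim True by (auto simp: filterlim_at)
    then have "filterlim (\<lambda>z. inverse (inverse (f z))) at_infinity (at z0)"
      by (rule filterlim_compose[OF filterlim_inverse_at_infinity])
    then show ?thesis by simp
  qed
qed

text \<open>By exhaustion with compact sets; this feeds the countability of the zeros of the
  derivative of \<open>f\<close>.\<close>

lemma open_imp_fsigma:
  fixes S :: "'a::euclidean_space set"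
  assumes "open S"
  shows "fsigma S"
proof -
  obtain C :: "nat \<Rightarrow> 'a set" where "\<And>n. compact (C n)" "\<Union>(range C) = S"
    using open_Union_compact_subsets[OF assms] by metis
  then show ?thesis
    unfolding fsigma_Union_compact by (intro exI[of _ C]) auto
qed

text \<open>One colour must serve all neighbourhoods. Picard's exceptional value may vary with the
  disc, but a sequence of shrinking discs has only countably many, and the critical values are
  countable too.\<close>

lemma infinitely_many_components_near_essential_singularity:
  assumes "r > 0" and holf: "f holomorphic_on ball z0 r - {z0}"
    and nolim: "\<And>a. \<not> f \<midarrow>z0\<rightarrow> a" and nopole: "\<not> filterlim f at_infinity (at z0)"
  obtains c where "norm c = 1"
    "\<And>e. e > 0 \<Longrightarrow> infinite {L \<in> components {z \<in> ball z0 r - {z0}. deriv f z \<noteq> 0 \<and> f z \<in> ray c}.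
       L \<inter> ball z0 e \<noteq> {}}"
proof -
  let ?U = "ball z0 r - {z0}"
  have U: "open ?U" "connected ?U"
    by (auto intro: connected_punctured_ball)
  have "\<exists>a. \<forall>w. w \<noteq> a \<longrightarrow> infinite {x \<in> ball z0 (min r (inverse (Suc n))) - {z0}. f x = w}" for n :: nat
  proof -
    have z0: "z0 \<in> ball z0 (min r (inverse (Suc n)))" using \<open>r > 0\<close> by simp
    have hol: "f holomorphic_on ball z0 (min r (inverse (Suc n))) - {z0}"
      using holf by (rule holomorphic_on_subset) auto
    have "\<not> ((inverse \<circ> f) \<longlongrightarrow> l) (at z0)" for l
      using tendsto_or_pole_if_inverse_tendsto[OF \<open>r > 0\<close> holf] nolim nopole by (auto simp: o_def)
    from great_Picard_infinite[OF open_ball z0 hol nolim this] show ?thesis by metis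
  qed
  then obtain a where a: "\<And>n w. w \<noteq> a n \<Longrightarrow>
      infinite {x \<in> ball z0 (min r (inverse (Suc n))) - {z0}. f x = w}"
    by metis
  \<comment> \<open>The zeros of a non-constant holomorphic derivative are countable. A constant
    derivative is not 0 here, since \<open>f\<close> would be constant and have a limit.\<close>
  have "countable {z \<in> ?U. deriv f z = 0}"
  proof (cases "deriv f constant_on ?U")
    case False
    then show ?thesis
      using holomorphic_countable_zeros[OF holomorphic_deriv[OF holf U(1)] U open_imp_fsigma[OF U(1)]] by blast
  next
    case True
    then obtain b where b: "\<And>z. z \<in> ?U \<Longrightarrow> deriv f z = b" by (auto simp: constant_on_def)
    have "b \<noteq> 0"
    proof
      assume "b = 0"
      then have "(f has_field_derivative 0) (at z)" if "z \<in> ?U" for z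
        using holomorphic_derivI[OF holf U(1) that] b[OF that] by simp
      then obtain k where k: "\<And>z. z \<in> ?U \<Longrightarrow> f z = k"
        using DERIV_zero_connected_constant_on[OF U(2,1), of "{}" f]
          holomorphic_on_imp_continuous_on[OF holf] unfolding constant_on_def by (metis finite.emptyI Diff_empty)
      have "\<forall>\<^sub>F z in at z0. z \<in> ?U"
        using eventually_at_in_open[of "ball z0 r" z0] \<open>r > 0\<close> by simp
      then have "\<forall>\<^sub>F z in at z0. f z = k" by (rule eventually_mono) (use k in auto)
      then show False using nolim tendsto_eventually by blast
    qed
    then have "{z \<in> ?U. deriv f z = 0} = {}" using b by auto
    then show ?thesis by (metis countable_empty)
  qed
  then have "countable (insert 0 (range a \<union> f ` {z \<in> ?U. deriv f z = 0}))"
    by auto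
  \<comment> \<open>Non-zero, so that \<open>w\<close> has a phase; outside \<open>range a\<close>,
    so that each disc contains infinitely many preimages; not a critical value, so that they all lie
    on lines.\<close>
  then obtain w where w: "w \<notin> insert 0 (range a \<union> f ` {z \<in> ?U. deriv f z = 0})"
    using uncountable_UNIV_complex by (metis UNIV_I countable_subset subsetI)
  define c where "c = w / of_real (norm w)"
  have c: "norm c = 1" "w \<in> ray c"
    using w by (auto simp: c_def norm_divide ray_def intro!: image_eqI[of _ _ "norm w"])
  let ?S = "{z \<in> ?U. deriv f z \<noteq> 0 \<and> f z \<in> ray c}"
  show ?thesis
  proof (rule that[OF c(1)])
    fix e :: real assume "e > 0"
    then obtain n where n: "inverse (Suc n) < e" using reals_Archimedean by blast
    define X where "X = {x \<in> ball z0 (min r (inverse (Suc n))) - {z0}. f x = w}"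
    have "infinite X" unfolding X_def using w by (intro a) auto
    have XS: "X \<subseteq> ?S" using w c(2) by (auto simp: X_def)
    have comp: "connected_component_set ?S x \<in> components ?S" if "x \<in> X" for x
      using that XS by (auto simp: components_def)
    have mem: "x \<in> connected_component_set ?S x" if "x \<in> X" for x
      using that XS by (auto simp: connected_component_refl_eq)
    \<comment> \<open>\<open>f\<close> is injective on each component, so distinct preimages of
      \<open>w\<close> lie on distinct lines.\<close>
    have "inj_on (connected_component_set ?S) X"
    proof (rule inj_onI)
      fix x y assume xy: "x \<in> X" "y \<in> X" "connected_component_set ?S x = connected_component_set ?S y"
      then have "y \<in> connected_component_set ?S x" using mem by blast
      then show "x = y"
        using inj_onD[OF inj_on_noncritical_ray_preimage_component[OF holf U(1) comp[OF xy(1)]], of x y]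
          mem[OF xy(1)] xy(1,2) by (auto simp: X_def)
    qed
    then have "infinite (connected_component_set ?S ` X)"
      using \<open>infinite X\<close> finite_imageD by blast
    moreover have "connected_component_set ?S ` X \<subseteq> {L \<in> components ?S. L \<inter> ball z0 e \<noteq> {}}"
    proof clarify
      fix x assume x: "x \<in> X"
      then have "x \<in> ball z0 e" using n by (auto simp: X_def)
      then show "connected_component_set ?S x \<in> components ?S \<and> connected_component_set ?S x \<inter> ball z0 e \<noteq> {}"
        using comp[OF x] mem[OF x] by blast
    qed
    ultimately show "infinite {L \<in> components ?S. L \<inter> ball z0 e \<noteq> {}}"
      using finite_subset by blast
  qed
qed

section \<open>Essential singularities characterised by isochromatic lines\<close>

theorem theorem2:
  fixes f :: "complex \<Rightarrow> complex" and z0 :: complex and r :: real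
  assumes "r > 0"
    and "f analytic_on (ball z0 r - {z0})"
  shows "\<not> not_essential f z0 \<longleftrightarrow>
    (\<exists>c. norm c = 1 \<and>
       (\<forall>e>0. infinite {L \<in> isochromatic_lines f (ball z0 r - {z0}) c. L \<inter> ball z0 e \<noteq> {}}))"
proof -
  let ?U = "ball z0 r - {z0}"
  have holf: "f holomorphic_on ?U"
    using assms(2) by (rule analytic_imp_holomorphic)
  show ?thesis
  proof
    assume "\<not> not_essential f z0"
    then have sing: "\<And>a. \<not> f \<midarrow>z0\<rightarrow> a" "\<not> filterlim f at_infinity (at z0)"
      by (auto simp: not_essential_def is_pole_def)
    obtain c where "norm c = 1"
      "\<And>e. e > 0 \<Longrightarrow> infinite {L \<in> components {z \<in> ?U. deriv f z \<noteq> 0 \<and> f z \<in> ray c}. L \<inter> ball z0 e \<noteq> {}}"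
      by (rule infinitely_many_components_near_essential_singularity[OF assms(1) holf sing], rule that)
    then show "\<exists>c. norm c = 1 \<and> (\<forall>e>0. infinite {L \<in> isochromatic_lines f ?U c. L \<inter> ball z0 e \<noteq> {}})"
      by (intro exI[of _ c]) (simp add: isochromatic_lines_eq)
  next
    assume "\<exists>c. norm c = 1 \<and> (\<forall>e>0. infinite {L \<in> isochromatic_lines f ?U c. L \<inter> ball z0 e \<noteq> {}})"
    then obtain c where c: "norm c = 1"
      and inf: "\<And>e. e > 0 \<Longrightarrow> infinite {L \<in> isochromatic_lines f ?U c. L \<inter> ball z0 e \<noteq> {}}"
      by blast
    show "\<not> not_essential f z0"
    proof
      assume "not_essential f z0"
      \<comment> \<open>A finite limit and a pole each yield a \<open>V\<close> meeting only
        finitely many lines of colour \<open>c\<close>; a ball inside \<open>V\<close> then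
        contradicts \<open>inf\<close>.\<close>
      then consider (lim) a where "f \<midarrow>z0\<rightarrow> a" | (pole) "filterlim f at_infinity (at z0)"
        by (auto simp: not_essential_def is_pole_def)
      then obtain V where V: "open V" "z0 \<in> V"
        and fin: "finite {L \<in> isochromatic_lines f ?U c. L \<inter> V \<noteq> {}}"
        unfolding isochromatic_lines_eq[OF c]
        using finite_components_near_removable_singularity[OF assms(1) holf _ c]
          finite_components_near_pole[OF assms(1) holf]
        by cases blast+
      obtain e where e: "e > 0" "ball z0 e \<subseteq> V"
        using V open_contains_ball by blast
      have "{L \<in> isochromatic_lines f ?U c. L \<inter> ball z0 e \<noteq> {}} \<subseteq> {L \<in> isochromatic_lines f ?U c. L \<inter> V \<noteq> {}}"
        using e(2) by blast
      then show False using inf[OF e(1)] fin finite_subset by blast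
    qed
  qed
qed

end
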